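(* Let $1\le d<n$ be integers and let $\mathcal{L}=\{(\mathbf{t},A\mathbf{t}+\mathbf{b}):\mathbf{t}\in\mathbb{R}^d\}$ be a $d$-dimensional affine subspace of $\mathbb{R}^n$ whose projection onto any axis-aligned subspace of dimension $d$ is surjective, where $A=(\mathbf{a}^{(1)},\ldots,\mathbf{a}^{(d)})\in\mathbb{R}^{(n-d)\times d}$ and $\mathbf{b}\in\mathbb{R}^{n-d}$. Let $\gamma>1$ and $\sigma_2\ge 1/(n-d)$ be real numbers. Assume that, for infinitely many positive integers $T$, there exists $\boldsymbol{\xi}=\boldsymbol{\xi}_T\in\mathbb{Z}^{n-d}\setminus\{\mathbf{0}\}$ such that \[ \max\{\|\boldsymbol{\xi}\cdot\mathbf{a}^{(1)}\|,\ldots,\|\boldsymbol{\xi}\cdot\mathbf{a}^{(d)}\|,\|\boldsymbol{\xi}\cdot\mathbf{b}\|\}<T^{-\gamma(1+d\sigma_2)} \] and \[ |\boldsymbol{\xi}|\le T^{\sigma_2},\qquad H(\boldsymbol{\xi})\le T. \] Then all points on $\mathcal{L}$ are very well multiplicatively approximable, and in particular (the induced Lebesgue measure on) $\mathcal{L}$ is not convergent Gallagher.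
   Context: For $x\in\mathbb{R}$, $\|x\|$ is the distance from $x$ to the nearest integer. For $\mathbf{m}\in\mathbb{Z}^k$, $|\mathbf{m}|=\max_j|m_j|$ and $H(\mathbf{m})=\prod_{j\le k}\max\{1,|m_j|\}$. A vector $\mathbf{x}\in\mathbb{R}^n$ is very well multiplicatively approximable (VWMA) if it satisfies the following (known to be equivalent) conditions: (i) for some $\tau>1$ there are infinitely many $q\in\mathbb{Z}$ with $\|qx_1\|\cdots\|qx_n\|<|q|^{-\tau}$; (ii) for some $\tau>1$ there are infinitely many $\mathbf{m}\in\mathbb{Z}^n$ with $\|\mathbf{m}\cdot\mathbf{x}\|<H(\mathbf{m})^{-\tau}$. A Borel measure $\mu$ on $\mathbb{R}^n$ is convergent Gallagher if, for every non-increasing $\psi:\mathbb{N}\to[0,1)$ with $\sum_{q\ge1}\psi(q)(\log q)^{n-1}<\infty$, one has $\mu(\mathcal{W}_n^\times(\psi))=0$, where $\mathcal{W}_n^\times(\psi)$ is the set of $\mathbf{x}\in\mathbb{R}^n$ such that $\prod_{i\le n}\|qx_i\|<\psi(q)$ for infinitely many $q\in\mathbb{N}$. *)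

theory Defs
  imports "HOL-Analysis.Analysis"
begin

text \<open>Vectors are indexed by finite types. A \<open>d\<close>-dimensional affine subspace of
  \<open>n\<close>-space given by a matrix with \<open>n - d\<close> rows and \<open>d\<close> columns lives in
  \<open>real ^ ('d + 'm)\<close>, where \<open>CARD('d) = d\<close>, \<open>CARD('m) = n - d\<close>, and hence
  \<open>CARD('d + 'm) = n\<close>. Index types are nonempty, so this covers exactly \<open>1 \<le> d < n\<close>.\<close>

definition nint_dist :: "real \<Rightarrow> real" where
  "nint_dist x = \<bar>x - of_int (round x)\<bar>"

definition real_vec :: "int ^ 'k \<Rightarrow> real ^ 'k" where
  "real_vec m = (\<chi> i. of_int (m $ i))"

definition max_norm :: "int ^ 'k::finite \<Rightarrow> int" where
  "max_norm m = Max (range (\<lambda>i. \<bar>m $ i\<bar>))"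

definition mult_height :: "int ^ 'k::finite \<Rightarrow> int" where
  "mult_height m = (\<Prod>i\<in>UNIV. max 1 \<bar>m $ i\<bar>)"

definition vwma_simultaneous :: "real ^ 'n::finite \<Rightarrow> bool" where
  "vwma_simultaneous x \<longleftrightarrow>
    (\<exists>\<tau>>1. infinite {q::int.
      (\<Prod>i\<in>UNIV. nint_dist (of_int q * x $ i)) < (of_int \<bar>q\<bar>) powr (- \<tau>)})"

definition vwma_dual :: "real ^ 'n::finite \<Rightarrow> bool" where
  "vwma_dual x \<longleftrightarrow>
    (\<exists>\<tau>>1. infinite {m :: int ^ 'n.
      nint_dist (real_vec m \<bullet> x) < (of_int (mult_height m)) powr (- \<tau>)})"

text \<open>The two conditions are equivalent by a transference theorem. That theorem is not built
  into the definition, which asks for both of them.\<close>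

definition very_well_mult_approximable :: "real ^ 'n::finite \<Rightarrow> bool" where
  "very_well_mult_approximable x \<longleftrightarrow> vwma_simultaneous x \<and> vwma_dual x"

definition W_mult :: "(nat \<Rightarrow> real) \<Rightarrow> (real ^ 'n::finite) set" where
  "W_mult \<psi> = {x. infinite {q::nat. q \<ge> 1 \<and>
      (\<Prod>i\<in>UNIV. nint_dist (of_nat q * x $ i)) < \<psi> q}}"

text \<open>To be used for Borel measures. Approximation functions are defined on the positive
  integers, so their value at \<open>0\<close> is ignored throughout and the series is shifted
  by one. Its terms are nonnegative, so summability is finiteness of the sum.\<close>

definition convergent_Gallagher :: "(real ^ 'n::finite) measure \<Rightarrow> bool" where
  "convergent_Gallagher \<mu> \<longleftrightarrow>
    (\<forall>\<psi> :: nat \<Rightarrow> real.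
      (\<forall>q\<ge>1. 0 \<le> \<psi> q \<and> \<psi> q < 1) \<longrightarrow>
      (\<forall>p q. 1 \<le> p \<and> p \<le> q \<longrightarrow> \<psi> q \<le> \<psi> p) \<longrightarrow>
      summable (\<lambda>q. \<psi> (Suc q) * ln (real (Suc q)) ^ (CARD('n) - 1)) \<longrightarrow>
      emeasure \<mu> (W_mult \<psi>) = 0)"

text \<open>The graph parametrization \<open>t \<mapsto> (t, A t + b)\<close>.\<close>

definition graph_point :: "real ^ 'd ^ 'm \<Rightarrow> real ^ 'm \<Rightarrow> real ^ 'd \<Rightarrow> real ^ ('d::finite + 'm::finite)"
  where
  "graph_point A b t = (\<chi> k. case k of Inl j \<Rightarrow> t $ j | Inr i \<Rightarrow> (A *v t + b) $ i)"

definition affine_graph :: "real ^ 'd ^ 'm \<Rightarrow> real ^ 'm \<Rightarrow> (real ^ ('d::finite + 'm::finite)) set"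
  where
  "affine_graph A b = range (graph_point A b)"

text \<open>Orthogonal projection onto the axis-aligned subspace spanned by the coordinates in \<open>S\<close>.\<close>

definition axis_proj :: "'n set \<Rightarrow> real ^ 'n \<Rightarrow> real ^ 'n" where
  "axis_proj S x = (\<chi> i. if i \<in> S then x $ i else 0)"

definition axis_subspace :: "'n set \<Rightarrow> (real ^ 'n) set" where
  "axis_subspace S = {x. \<forall>i. i \<notin> S \<longrightarrow> x $ i = 0}"

text \<open>The surface measure of the graph: by the area formula it is the image of Lebesgue measure
  under the parametrization, times the constant square root of the Gram determinant of the
  derivative \<open>t \<mapsto> (t, A t)\<close>.\<close>

definition induced_lebesgue ::
    "real ^ 'd ^ 'm \<Rightarrow> real ^ 'm \<Rightarrow> (real ^ ('d::finite + 'm::finite)) measure" where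
  "induced_lebesgue A b =
    scale_measure (ennreal (sqrt (det (mat 1 + transpose A ** A))))
      (distr lborel borel (graph_point A b))"

end

theory Submission
  imports Defs
begin

text \<open>
  The hypothesis provides integer combinations \<open>\<xi>\<close> of the rows of \<open>(A, b)\<close> that are extremely
  close to integer vectors. Moving these integers to the other side, each \<open>\<xi>\<close> becomes an integer
  form \<open>m\<close> in all \<open>n\<close> variables whose value at any point \<open>x\<close> of the subspace is close to an
  integer. The first \<open>d\<close> coefficients of \<open>m\<close> are of size \<open>O(T powr \<sigma>\<^sub>2)\<close>, so
  the height of \<open>m\<close> is \<open>O(T powr (1 + d * \<sigma>\<^sub>2))\<close>. As the distance to the integers is
  \<open>O(T powr (- \<gamma> * (1 + d * \<sigma>\<^sub>2)))\<close>, every exponent \<open>\<tau> < \<gamma>\<close> works in the dual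
  condition, at all points of the subspace at once (\<open>dual_on_affine_graph\<close>).

  The simultaneous condition follows by a multiplicative transference argument. Let the value of
  \<open>m\<close> at \<open>x\<close> be \<open>m0 + \<delta>\<close> with \<open>m0\<close> an integer and \<open>\<delta>\<close> tiny. Integer points \<open>(q, p)\<close> on the
  hyperplane \<open>m \<bullet> p = q * m0\<close> have errors \<open>y = q * x - p\<close> that satisfy \<open>m \<bullet> y = q * \<delta>\<close>, so an
  error coordinate \<open>y k\<close> with \<open>m k \<noteq> 0\<close> is controlled by the others. Running the pigeonhole
  principle inside this sublattice with boxes of side \<open>1 / (R * max 1 \<bar>m i\<bar>)\<close> in the coordinates
  \<open>i \<noteq> k\<close> therefore wins an additional factor \<open>R\<close> over the trivial bound: the product of the
  errors is \<open>O(1 / (R * N))\<close> with \<open>q \<le> N\<close> (\<open>transference\<close>). Choosing \<open>R\<close> as a small power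
  of the height turns this factor into a gain in the exponent (\<open>simultaneous_from_dual\<close>).

  The exponent \<open>\<kappa> > 1\<close> obtained in this way depends only on \<open>\<tau>\<close> and \<open>n\<close>, not on \<open>x\<close>. Hence the
  whole subspace lies in the set of points that are approximable with respect to the single function
  \<open>\<psi> q = q powr -\<kappa> / 2\<close>, for which the Gallagher series converges; and the induced measure of
  the subspace is infinite.
\<close>

section \<open>Distance to the nearest integer and height\<close>

lemma nint_dist_nonneg: "0 \<le> nint_dist x"
  by (simp add: nint_dist_def)

lemma nint_dist_le: "nint_dist x \<le> \<bar>x - of_int p\<bar>"
  unfolding nint_dist_def by (rule round_diff_minimal)

lemma nint_dist_of_int [simp]: "nint_dist (of_int p) = 0"
  by (simp add: nint_dist_def)

lemma nint_dist_eq_0_iff: "nint_dist x = 0 \<longleftrightarrow> x \<in> \<int>"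
proof
  assume "nint_dist x = 0"
  then have "x = of_int (round x)" by (simp add: nint_dist_def)
  then show "x \<in> \<int>" by (metis Ints_of_int)
next
  assume "x \<in> \<int>"
  then show "nint_dist x = 0" by (auto elim!: Ints_cases)
qed

lemma mult_height_ge_1: "1 \<le> mult_height m"
  unfolding mult_height_def by (rule prod_ge_1) simp

lemma abs_entry_le_mult_height: "\<bar>m $ i\<bar> \<le> mult_height m"
proof -
  have "\<bar>m $ i\<bar> \<le> max 1 \<bar>m $ i\<bar>" by simp
  also have "\<dots> \<le> max 1 \<bar>m $ i\<bar> * (\<Prod>j\<in>UNIV - {i}. max 1 \<bar>m $ j\<bar>)"
    using mult_left_mono[of 1 "\<Prod>j\<in>UNIV - {i}. max 1 \<bar>m $ j\<bar>" "max 1 \<bar>m $ i\<bar>"]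
    by (simp add: prod_ge_1)
  also have "\<dots> = mult_height m"
    unfolding mult_height_def by (rule prod.remove[symmetric]) auto
  finally show ?thesis .
qed

lemma finite_mult_height_le: "finite {m :: int ^ 'n::finite. mult_height m \<le> B}"
proof (rule finite_subset)
  show "{m :: int ^ 'n. mult_height m \<le> B} \<subseteq> vec_lambda ` (PiE UNIV (\<lambda>_. {-B..B}))"
  proof
    fix m :: "int ^ 'n"
    assume "m \<in> {m. mult_height m \<le> B}"
    then have "\<bar>m $ i\<bar> \<le> B" for i
      using abs_entry_le_mult_height[of m i] by simp
    then have "($) m \<in> PiE UNIV (\<lambda>_. {-B..B})"
      by (auto simp: abs_le_iff minus_le_iff)
    moreover have "m = vec_lambda (($) m)" by simp
    ultimately show "m \<in> vec_lambda ` (PiE UNIV (\<lambda>_. {-B..B}))" by blast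
  qed
  show "finite (vec_lambda ` (PiE UNIV (\<lambda>_ :: 'n. {-B..B})))"
    by (intro finite_imageI finite_PiE) auto
qed

text \<open>This produces infinitely many solutions of a Diophantine inequality from arbitrarily good ones. If
  there were only finitely many, then a small enough value of \<open>f\<close> would be zero, which is an exact solution; for the
  inequalities below the multiples of an exact solution are exact solutions again.\<close>

lemma infinite_if_arbitrarily_small:
  fixes f :: "'a \<Rightarrow> real"
  assumes small: "\<And>\<epsilon>. \<epsilon> > 0 \<Longrightarrow> \<exists>a\<in>S. f a < \<epsilon>"
    and nonneg: "\<And>a. a \<in> S \<Longrightarrow> f a \<ge> 0"
    and zero: "\<And>a. a \<in> S \<Longrightarrow> f a = 0 \<Longrightarrow> infinite S"
  shows "infinite S"
proof
  assume fin: "finite S"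
  have ne: "S \<noteq> {}" using small[of 1] by auto
  have "0 < Min (f ` S)"
    using fin ne nonneg zero by (subst Min_gr_iff) (auto simp: less_le)
  from small[OF this] obtain a where "a \<in> S" "f a < Min (f ` S)" by auto
  then show False using fin by (meson Min_le finite_imageI imageI not_le)
qed

section \<open>Transference from linear forms to simultaneous approximation\<close>

text \<open>Dirichlet's argument, restricted to the integer points with \<open>m \<bullet> p = q * m0\<close>. For
  \<open>i \<noteq> k\<close> the fractional part of \<open>q * x i\<close> is sorted into \<open>R * max 1 \<bar>m i\<bar>\<close> equal
  intervals. The missing coordinate \<open>p k\<close> exists exactly when a certain residue modulo \<open>m k\<close>
  vanishes, so recording this residue for each candidate \<open>q\<close> costs only a factor \<open>\<bar>m k\<bar>\<close>, and
  the number of pigeonholes is \<open>R\<close> to the power \<open>n - 1\<close> times the height of \<open>m\<close>.\<close>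

lemma pigeonhole_in_sublattice:
  fixes x :: "real ^ 'n::finite" and m :: "int ^ 'n" and m0 :: int and R :: nat
  assumes mk: "m $ k \<noteq> 0" and R: "R \<ge> 1"
  obtains q :: nat and p :: "'n \<Rightarrow> int"
  where "1 \<le> q" "int q \<le> int R ^ (CARD('n) - 1) * mult_height m"
    "\<And>i. i \<noteq> k \<Longrightarrow> \<bar>real q * x $ i - of_int (p i)\<bar> * (real R * of_int (max 1 \<bar>m $ i\<bar>)) < 1"
    "(\<Sum>i\<in>UNIV. m $ i * p i) = int q * m0"
proof -
  define w where "w i = max 1 \<bar>m $ i\<bar>" for i
  have w1: "w i \<ge> 1" for i by (simp add: w_def)
  define N where "N = nat (int R ^ (CARD('n) - 1) * mult_height m)"
  have intN: "int N = int R ^ (CARD('n) - 1) * mult_height m"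
    using mult_height_ge_1[of m] by (simp add: N_def)
  define c where "c q = (int q * m0 - (\<Sum>i\<in>UNIV - {k}. m $ i * \<lfloor>real q * x $ i\<rfloor>)) mod \<bar>m $ k\<bar>" for q
  \<comment> \<open>The pigeonhole of \<open>q\<close>, as a function on the coordinates with values in \<open>box\<close>.\<close>
  define F where "F q i = (if i = k then c q else \<lfloor>real R * of_int (w i) * frac (real q * x $ i)\<rfloor>)"
    for q i
  define box where "box i = (if i = k then {0..<w k} else {0..<int R * w i})" for i
  have "card (PiE UNIV box) = (\<Prod>i\<in>UNIV. card (box i))"
    by (simp add: card_PiE)
  also have "int \<dots> = (\<Prod>i\<in>UNIV. int (card (box i)))" by simp
  also have "\<dots> = int (card (box k)) * (\<Prod>i\<in>UNIV - {k}. int (card (box i)))"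
    by (rule prod.remove) auto
  also have "\<dots> = w k * (\<Prod>i\<in>UNIV - {k}. int R * w i)"
  proof -
    have "(\<Prod>i\<in>UNIV - {k}. int (card (box i))) = (\<Prod>i\<in>UNIV - {k}. int R * w i)"
    proof (rule prod.cong)
      show "int (card (box i)) = int R * w i" if "i \<in> UNIV - {k}" for i
        using that w1[of i] by (simp add: box_def)
    qed simp
    moreover have "int (card (box k)) = w k" using w1[of k] by (simp add: box_def)
    ultimately show ?thesis by (simp only:)
  qed
  also have "\<dots> = int R ^ (CARD('n) - 1) * (w k * (\<Prod>i\<in>UNIV - {k}. w i))"
    by (simp add: prod.distrib card_Diff_subset)
  also have "w k * (\<Prod>i\<in>UNIV - {k}. w i) = mult_height m"
    unfolding mult_height_def w_def by (rule prod.remove[symmetric]) auto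
  finally have card_box: "card (PiE UNIV box) = N" using intN by simp
  have F_box: "F q \<in> PiE UNIV box" for q
  proof -
    have "F q i \<in> box i" for i
    proof (cases "i = k")
      case True
      have "w k = \<bar>m $ k\<bar>" using mk by (simp add: w_def)
      then show ?thesis using True mk by (simp add: F_def box_def c_def)
    next
      case False
      have "real R * of_int (w i) * frac (real q * x $ i) < real R * of_int (w i) * 1"
        using R w1[of i] by (intro mult_strict_left_mono frac_lt_1) auto
      then have "real R * of_int (w i) * frac (real q * x $ i) < of_int (int R * w i)" by simp
      then have "\<lfloor>real R * of_int (w i) * frac (real q * x $ i)\<rfloor> < int R * w i"
        by (simp only: floor_less_iff)
      moreover have "0 \<le> real R * of_int (w i) * frac (real q * x $ i)"
        using w1[of i] by auto
      ultimately show ?thesis using False by (simp add: F_def box_def)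
    qed
    then show ?thesis by auto
  qed
  have finbox: "finite (PiE UNIV box)"
    by (intro finite_PiE) (auto simp: box_def)
  have "\<not> inj_on F {0..N}"
  proof
    assume "inj_on F {0..N}"
    then have "card {0..N} \<le> card (PiE UNIV box)"
      by (rule card_inj_on_le) (use F_box finbox in auto)
    then show False using card_box by simp
  qed
  then obtain a b where "a \<in> {0..N}" "b \<in> {0..N}" "a \<noteq> b" "F a = F b"
    unfolding inj_on_def by blast
  then obtain q1 q2 where q12: "q1 < q2" "q2 \<le> N" "F q1 = F q2"
    by (metis atLeastAtMost_iff linorder_neqE_nat)
  define p' where "p' i = \<lfloor>real q2 * x $ i\<rfloor> - \<lfloor>real q1 * x $ i\<rfloor>" for i
  define s where "s = int (q2 - q1) * m0 - (\<Sum>i\<in>UNIV - {k}. m $ i * p' i)"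
  \<comment> \<open>The division is exact, by equality of the residues at \<open>k\<close>.\<close>
  define p where "p = p'(k := s div m $ k)"
  have "c q2 = c q1" using fun_cong[OF q12(3), of k] by (simp add: F_def)
  then have "\<bar>m $ k\<bar> dvd (int q2 * m0 - (\<Sum>i\<in>UNIV - {k}. m $ i * \<lfloor>real q2 * x $ i\<rfloor>))
      - (int q1 * m0 - (\<Sum>i\<in>UNIV - {k}. m $ i * \<lfloor>real q1 * x $ i\<rfloor>))"
    unfolding c_def by (simp only: mod_eq_dvd_iff)
  also have "\<dots> = s"
    using q12(1) by (simp add: s_def p'_def of_nat_diff algebra_simps sum_subtractf)
  finally have dvd: "m $ k dvd s" by simp
  show thesis
  proof (rule that)
    show "1 \<le> q2 - q1" using q12(1) by simp
    show "int (q2 - q1) \<le> int R ^ (CARD('n) - 1) * mult_height m"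
      using q12(1,2) unfolding intN[symmetric] by simp
    show "\<bar>real (q2 - q1) * x $ i - of_int (p i)\<bar> * (real R * of_int (max 1 \<bar>m $ i\<bar>)) < 1"
      if "i \<noteq> k" for i
    proof -
      have "\<lfloor>real R * of_int (w i) * frac (real q1 * x $ i)\<rfloor>
          = \<lfloor>real R * of_int (w i) * frac (real q2 * x $ i)\<rfloor>"
        using fun_cong[OF q12(3), of i] that by (simp add: F_def)
      then have "\<bar>real R * of_int (w i) * frac (real q2 * x $ i)
          - real R * of_int (w i) * frac (real q1 * x $ i)\<bar> < 1"
        by linarith
      also have "real R * of_int (w i) * frac (real q2 * x $ i)
          - real R * of_int (w i) * frac (real q1 * x $ i)
          = (real (q2 - q1) * x $ i - of_int (p i)) * (real R * of_int (w i))"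
        using that q12(1) by (simp add: p_def p'_def frac_def of_nat_diff algebra_simps)
      finally show ?thesis
        using w1[of i] by (simp add: abs_mult w_def)
    qed
    have "(\<Sum>i\<in>UNIV. m $ i * p i) = m $ k * p k + (\<Sum>i\<in>UNIV - {k}. m $ i * p i)"
      by (rule sum.remove) auto
    also have "m $ k * p k = s" using dvd by (simp add: p_def)
    also have "(\<Sum>i\<in>UNIV - {k}. m $ i * p i) = (\<Sum>i\<in>UNIV - {k}. m $ i * p' i)"
      by (rule sum.cong) (auto simp: p_def)
    finally show "(\<Sum>i\<in>UNIV. m $ i * p i) = int (q2 - q1) * m0" by (simp add: s_def)
  qed
qed

text \<open>At the points of the sublattice the errors \<open>y i\<close> satisfy \<open>m \<bullet> y = q * \<delta>\<close>. Each summand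
  \<open>m i * y i\<close> with \<open>i \<noteq> k\<close> is at most \<open>1 / R\<close>, and the hypothesis makes \<open>q * \<delta>\<close> at most
  \<open>1 / R\<close> as well. So \<open>m k * y k\<close> is at most \<open>n / R\<close>, although the pigeonholes do not
  restrict \<open>y k\<close>.\<close>

lemma transference:
  fixes x :: "real ^ 'n::finite" and m :: "int ^ 'n" and R :: nat
  assumes m: "m \<noteq> 0" and R: "R \<ge> 1"
    and close: "nint_dist (real_vec m \<bullet> x) * of_int (mult_height m) * real R ^ CARD('n) \<le> 1"
  obtains q :: nat
  where "1 \<le> q" "real q \<le> real R ^ (CARD('n) - 1) * of_int (mult_height m)"
    "(\<Prod>i\<in>UNIV. nint_dist (real q * x $ i))
      \<le> real CARD('n) / (real R ^ CARD('n) * of_int (mult_height m))"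
proof -
  obtain k where k: "m $ k \<noteq> 0" using m by (metis vec_eq_iff zero_index)
  define m0 where "m0 = round (real_vec m \<bullet> x)"
  define \<delta> where "\<delta> = real_vec m \<bullet> x - of_int m0"
  have \<delta>: "nint_dist (real_vec m \<bullet> x) = \<bar>\<delta>\<bar>" by (simp add: nint_dist_def \<delta>_def m0_def)
  define w where "w i = (of_int (max 1 \<bar>m $ i\<bar>) :: real)" for i
  have w1: "w i \<ge> 1" for i by (simp add: w_def)
  have mw: "\<bar>of_int (m $ i)\<bar> \<le> w i" for i by (simp add: w_def)
  have H: "of_int (mult_height m) = (\<Prod>i\<in>UNIV. w i)" by (simp add: mult_height_def w_def)
  have wk: "w k = \<bar>of_int (m $ k)\<bar>" using k by (simp add: w_def)
  obtain q p where q: "1 \<le> q" "int q \<le> int R ^ (CARD('n) - 1) * mult_height m"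
    and p: "\<And>i. i \<noteq> k \<Longrightarrow> \<bar>real q * x $ i - of_int (p i)\<bar> * (real R * w i) < 1"
    and mp: "(\<Sum>i\<in>UNIV. m $ i * p i) = int q * m0"
    unfolding w_def by (rule pigeonhole_in_sublattice[OF k R, of x m0]) blast
  define y where "y i = real q * x $ i - of_int (p i)" for i
  have qle: "real q \<le> real R ^ (CARD('n) - 1) * of_int (mult_height m)"
  proof -
    have "real_of_int (int q) \<le> of_int (int R ^ (CARD('n) - 1) * mult_height m)"
      using q(2) by (simp only: of_int_le_iff)
    then show ?thesis by simp
  qed
  have R0: "real R > 0" using R by simp
  have Rpow: "real R ^ CARD('n) = real R * real R ^ (CARD('n) - 1)"
    by (metis One_nat_def Suc_pred power_Suc zero_less_card_finite)
  have "(\<Sum>i\<in>UNIV. of_int (m $ i) * y i)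
      = real q * (\<Sum>i\<in>UNIV. of_int (m $ i) * x $ i) - of_int (\<Sum>i\<in>UNIV. m $ i * p i)"
    by (simp add: y_def algebra_simps sum_subtractf sum_distrib_left)
  also have "(\<Sum>i\<in>UNIV. of_int (m $ i) * x $ i) = \<delta> + of_int m0"
    by (simp add: \<delta>_def inner_vec_def real_vec_def)
  finally have my: "(\<Sum>i\<in>UNIV. of_int (m $ i) * y i) = real q * \<delta>"
    unfolding mp by (simp add: algebra_simps)
  have "(\<Sum>i\<in>UNIV. of_int (m $ i) * y i)
      = of_int (m $ k) * y k + (\<Sum>i\<in>UNIV - {k}. of_int (m $ i) * y i)"
    by (rule sum.remove) auto
  with my have "of_int (m $ k) * y k = real q * \<delta> - (\<Sum>i\<in>UNIV - {k}. of_int (m $ i) * y i)"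
    by simp
  then have "w k * \<bar>y k\<bar> \<le> real q * \<bar>\<delta>\<bar> + \<bar>\<Sum>i\<in>UNIV - {k}. of_int (m $ i) * y i\<bar>"
    unfolding wk abs_mult[symmetric] by (metis abs_mult abs_of_nat abs_triangle_ineq4)
  also have "\<bar>\<Sum>i\<in>UNIV - {k}. of_int (m $ i) * y i\<bar> \<le> (\<Sum>i\<in>UNIV - {k}. 1 / real R)"
  proof (rule order_trans[OF sum_abs sum_mono])
    fix i assume "i \<in> UNIV - {k}"
    then have "\<bar>y i\<bar> * (real R * w i) < 1" using p[of i] by (simp add: y_def)
    then have "\<bar>y i\<bar> * w i \<le> 1 / real R" using R0 by (simp add: field_simps)
    moreover have "\<bar>of_int (m $ i) * y i\<bar> \<le> \<bar>y i\<bar> * w i"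
      using mult_left_mono[OF mw[of i], of "\<bar>y i\<bar>"] by (simp add: abs_mult mult.commute)
    ultimately show "\<bar>of_int (m $ i) * y i\<bar> \<le> 1 / real R" by simp
  qed
  also have "\<dots> = (real CARD('n) - 1) / real R"
    by (simp add: card_Diff_subset of_nat_diff)
  also have "real q * \<bar>\<delta>\<bar> \<le> 1 / real R"
  proof -
    have "real q * \<bar>\<delta>\<bar> \<le> (real R ^ (CARD('n) - 1) * of_int (mult_height m)) * \<bar>\<delta>\<bar>"
      by (rule mult_right_mono[OF qle]) simp
    also have "\<dots> \<le> 1 / real R"
      using close R0 unfolding Rpow \<delta> by (simp add: field_simps)
    finally show ?thesis .
  qed
  finally have yk: "\<bar>y k\<bar> * (real R * w k) \<le> real CARD('n)"
    using R0 by (simp add: field_simps)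
  have pos: "0 < real R ^ CARD('n) * (\<Prod>i\<in>UNIV. w i)"
    using R0 w1 by (intro mult_pos_pos prod_pos zero_less_power) (auto intro: less_le_trans[of 0 1])
  have "(\<Prod>i\<in>UNIV. \<bar>y i\<bar>) * (real R ^ CARD('n) * (\<Prod>i\<in>UNIV. w i)) = (\<Prod>i\<in>UNIV. \<bar>y i\<bar> * (real R * w i))"
    by (simp add: prod.distrib)
  also have "\<dots> = \<bar>y k\<bar> * (real R * w k) * (\<Prod>i\<in>UNIV - {k}. \<bar>y i\<bar> * (real R * w i))"
    by (rule prod.remove) auto
  also have "\<dots> \<le> real CARD('n) * 1"
  proof (rule mult_mono[OF yk])
    show "(\<Prod>i\<in>UNIV - {k}. \<bar>y i\<bar> * (real R * w i)) \<le> 1"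
    proof (rule prod_le_1)
      fix i assume "i \<in> UNIV - {k}"
      then show "0 \<le> \<bar>y i\<bar> * (real R * w i) \<and> \<bar>y i\<bar> * (real R * w i) \<le> 1"
        using p[of i] w1[of i] by (auto simp: y_def intro: less_imp_le)
    qed
    show "0 \<le> (\<Prod>i\<in>UNIV - {k}. \<bar>y i\<bar> * (real R * w i))"
      using w1 by (intro prod_nonneg) (auto intro!: mult_nonneg_nonneg intro: order_trans[of 0 1])
  qed simp
  finally have "(\<Prod>i\<in>UNIV. \<bar>y i\<bar>) \<le> real CARD('n) / (real R ^ CARD('n) * of_int (mult_height m))"
    using pos unfolding H by (simp add: pos_le_divide_eq)
  moreover have "(\<Prod>i\<in>UNIV. nint_dist (real q * x $ i)) \<le> (\<Prod>i\<in>UNIV. \<bar>y i\<bar>)"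
    by (intro prod_mono) (auto simp: nint_dist_nonneg y_def nint_dist_le)
  ultimately have "(\<Prod>i\<in>UNIV. nint_dist (real q * x $ i))
      \<le> real CARD('n) / (real R ^ CARD('n) * of_int (mult_height m))"
    by linarith
  with q(1) qle show thesis by (rule that)
qed


text \<open>Write \<open>h\<close> for the height of \<open>m\<close>, and apply the transference with \<open>R\<close> about \<open>h powr s\<close>. The
  value of \<open>s\<close> is the largest for which the closeness condition there follows from the dual
  inequality. The factor \<open>R\<close> gained is split: one part \<open>h powr (s / 2)\<close> absorbs the
  constants, and the other is at least \<open>N powr (s / (2 * \<tau>))\<close> because the bound \<open>N\<close> on \<open>q\<close>
  is at most \<open>h powr \<tau>\<close>. The factor \<open>1 / 2\<close> in the conclusion leaves room for an approximation
  function that stays below \<open>1\<close> at \<open>q = 1\<close>.\<close>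

lemma simultaneous_from_dual:
  fixes x :: "real ^ 'n::finite"
  assumes \<tau>: "\<tau> > 1"
    and dual: "infinite {m :: int ^ 'n. nint_dist (real_vec m \<bullet> x) < of_int (mult_height m) powr - \<tau>}"
  defines "s \<equiv> (\<tau> - 1) / real CARD('n)"
  shows "infinite {q::nat. q \<ge> 1 \<and>
    (\<Prod>i\<in>UNIV. nint_dist (real q * x $ i)) < real q powr - (1 + s / (2 * \<tau>)) / 2}"
    (is "infinite ?S")
proof -
  define n where "n = real CARD('n)"
  have n1: "n \<ge> 1" by (simp add: n_def Suc_leI)
  have s: "s > 0" "s * n = \<tau> - 1" using \<tau> n1 by (auto simp: s_def n_def)
  let ?P = "\<lambda>q::nat. \<Prod>i\<in>UNIV. nint_dist (real q * x $ i)"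
  show ?thesis
  proof (rule infinite_if_arbitrarily_small[where f = ?P])
    fix \<epsilon> :: real
    assume \<epsilon>: "\<epsilon> > 0"
    \<comment> \<open>A height above \<open>B\<close> makes the constants negligible and the product smaller than \<open>\<epsilon>\<close>.\<close>
    define B where "B = \<lceil>max (1 / \<epsilon>) (max 1 ((4 * n) powr (2 / s)))\<rceil>"
    have "infinite ({m. nint_dist (real_vec m \<bullet> x) < of_int (mult_height m) powr - \<tau>}
        - {m. mult_height m \<le> B})"
      using dual finite_mult_height_le by (rule Diff_infinite_finite[rotated])
    then obtain m where m: "nint_dist (real_vec m \<bullet> x) < of_int (mult_height m) powr - \<tau>"
      and mB: "mult_height m > B"
      by (metis (no_types, lifting) DiffE ex_in_conv finite.emptyI mem_Collect_eq not_le)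
    define h where "h = real_of_int (mult_height m)"
    have "max (1 / \<epsilon>) (max 1 ((4 * n) powr (2 / s))) < h"
      using mB unfolding B_def h_def by linarith
    then have h: "1 / \<epsilon> < h" "1 < h" "(4 * n) powr (2 / s) < h" by auto
    have "4 * n = ((4 * n) powr (2 / s)) powr (s / 2)"
      using n1 s by (simp add: powr_powr)
    also have "\<dots> < h powr (s / 2)"
      using h(3) s by (intro powr_less_mono2) auto
    finally have g: "4 * n < h powr (s / 2)" .
    define R where "R = nat \<lfloor>h powr s\<rfloor>"
    have hs: "h powr s = h powr (s / 2) * h powr (s / 2)"
      by (simp flip: powr_add)
    have Rle: "real R \<le> h powr s" unfolding R_def by simp
    have "2 * n * h powr (s / 2) \<ge> 1"
      using n1 g by (smt (verit) mult_le_cancel_right1 mult_mono)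
    moreover have "4 * n * h powr (s / 2) \<le> h powr s"
      unfolding hs using g by (intro mult_right_mono) auto
    moreover have "real R > h powr s - 1" unfolding R_def by linarith
    ultimately have Rgt: "real R > 2 * n * h powr (s / 2)" by linarith
    have Rn: "real R > n"
      using Rgt n1 g by (smt (verit) mult_le_cancel_left1)
    then have R1: "R \<ge> 1" using n1 by linarith
    have "real R ^ CARD('n) \<le> (h powr s) ^ CARD('n)"
      by (intro power_mono Rle) simp
    also have "\<dots> = h powr (\<tau> - 1)"
      using s h(2) by (simp add: powr_power n_def mult.commute)
    finally have RN: "real R ^ CARD('n) \<le> h powr (\<tau> - 1)" .
    define N where "N = real R ^ (CARD('n) - 1) * h"
    have "real R ^ (CARD('n) - 1) \<ge> 1" using R1 by simp
    then have Nh: "h \<le> N" using h(2) by (simp add: N_def)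
    have "real R ^ (CARD('n) - 1) \<le> real R ^ CARD('n)"
      using R1 by (intro power_increasing) auto
    then have "N \<le> h powr (\<tau> - 1) * h"
      unfolding N_def using RN h(2) by (intro mult_right_mono) auto
    also have "\<dots> = h powr \<tau>"
      using h(2) by (metis add.commute add_diff_cancel_left' diff_add_cancel less_eq_real_def
          less_trans powr_add powr_one zero_less_one)
    finally have Nle: "N \<le> h powr \<tau>" .
    have m0: "m \<noteq> 0"
    proof
      assume "m = 0"
      then have "h = 1" by (simp add: h_def mult_height_def)
      with h(2) show False by simp
    qed
    have "nint_dist (real_vec m \<bullet> x) * h * real R ^ CARD('n) \<le> h powr - \<tau> * h * h powr (\<tau> - 1)"
      using m RN h(2) by (intro mult_mono) (auto simp: h_def nint_dist_nonneg)
    also have "\<dots> = h powr - \<tau> * h powr 1 * h powr (\<tau> - 1)" using h(2) by simp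
    also have "\<dots> = 1" using h(2) by (simp only: powr_add[symmetric]) simp
    finally have close: "nint_dist (real_vec m \<bullet> x) * h * real R ^ CARD('n) \<le> 1" .
    obtain q where q: "1 \<le> q" "real q \<le> N" "?P q \<le> n / (real R ^ CARD('n) * h)"
      using transference[OF m0 R1 close[unfolded h_def]] unfolding N_def n_def h_def by blast
    have "real R ^ CARD('n) = real R * real R ^ (CARD('n) - 1)"
      by (metis One_nat_def Suc_pred power_Suc zero_less_card_finite)
    then have P: "?P q \<le> n / (real R * N)" using q(3) by (simp add: N_def mult.assoc)
    have N0: "N > 0" using Nh h(2) by linarith
    have "N powr (1 + s / (2 * \<tau>)) = N * N powr (s / (2 * \<tau>))"
      using N0 by (simp add: powr_add)
    also have "N powr (s / (2 * \<tau>)) \<le> (h powr \<tau>) powr (s / (2 * \<tau>))"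
      using Nle N0 s \<tau> by (intro powr_mono2) auto
    also have "\<dots> = h powr (s / 2)" using \<tau> by (simp add: powr_powr)
    finally have Npow: "N powr (1 + s / (2 * \<tau>)) \<le> N * h powr (s / 2)"
      using N0 by simp
    have hp: "h powr (s / 2) > 0" using h(2) by simp
    note P
    also have "n / (real R * N) < 1 / (2 * (N * h powr (s / 2)))"
      using Rgt N0 hp R1 by (simp add: field_simps)
    also have "\<dots> \<le> 1 / (2 * N powr (1 + s / (2 * \<tau>)))"
      using Npow N0 hp by (intro divide_left_mono) auto
    also have "\<dots> = N powr - (1 + s / (2 * \<tau>)) / 2"
      by (simp add: powr_minus divide_simps)
    also have "\<dots> \<le> real q powr - (1 + s / (2 * \<tau>)) / 2"
    proof -
      have "s / (2 * \<tau>) > 0" using s \<tau> by simp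
      then show ?thesis using q by (intro divide_right_mono powr_mono2') auto
    qed
    finally have "q \<in> ?S" using q(1) by simp
    moreover have "?P q < \<epsilon>"
    proof -
      note P
      also have "n / (real R * N) < 1 / N" using Rn N0 R1 by (simp add: field_simps)
      also have "\<dots> \<le> 1 / h" using Nh N0 h(2) by (intro divide_left_mono) auto
      also have "\<dots> < \<epsilon>" using h \<epsilon> by (simp add: field_simps)
      finally show ?thesis .
    qed
    ultimately show "\<exists>q\<in>?S. ?P q < \<epsilon>" by blast
  next
    show "?P q \<ge> 0" for q by (intro prod_nonneg) (simp add: nint_dist_nonneg)
  next
    fix q assume q: "q \<in> ?S" "?P q = 0"
    then obtain i where "real q * x $ i \<in> \<int>" by (auto simp: nint_dist_eq_0_iff)
    then have "real (j * q) * x $ i \<in> \<int>" for j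
      using Ints_mult[OF Ints_of_nat[of j]] by (simp add: mult.assoc)
    then have zero: "?P (j * q) = 0" for j
      by (simp add: nint_dist_eq_0_iff) blast
    have "(\<lambda>j. j * q) ` {1..} \<subseteq> ?S"
    proof (rule image_subsetI)
      show "j * q \<in> ?S" if "j \<in> {1..}" for j
        using that q(1) unfolding mem_Collect_eq zero by simp
    qed
    moreover have "infinite ((\<lambda>j. j * q) ` {1..})"
      using q(1) by (subst finite_image_iff) (auto simp: inj_on_def infinite_Ici)
    ultimately show "infinite ?S" by (rule infinite_super)
  qed
qed

section \<open>Linear forms that are small on an affine subspace\<close>

lemma sum_UNIV_Plus:
  fixes f :: "'a::finite + 'b::finite \<Rightarrow> 'c::comm_monoid_add"
  shows "(\<Sum>k\<in>UNIV. f k) = (\<Sum>j\<in>UNIV. f (Inl j)) + (\<Sum>i\<in>UNIV. f (Inr i))"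
  using sum.Plus[of UNIV UNIV f] by (simp add: comp_def)

lemma prod_UNIV_Plus:
  fixes f :: "'a::finite + 'b::finite \<Rightarrow> 'c::comm_monoid_mult"
  shows "(\<Prod>k\<in>UNIV. f k) = (\<Prod>j\<in>UNIV. f (Inl j)) * (\<Prod>i\<in>UNIV. f (Inr i))"
  using prod.Plus[of UNIV UNIV f] by (simp add: comp_def)

text \<open>The first block is chosen so that, along the graph, the dependence on \<open>t\<close> cancels up to the
  rounding errors.\<close>

definition lift_form :: "real ^ 'd ^ 'm \<Rightarrow> int ^ 'm \<Rightarrow> int ^ ('d::finite + 'm::finite)" where
  "lift_form A \<xi> = (\<chi> k. case k of Inl j \<Rightarrow> - round (real_vec \<xi> \<bullet> column j A) | Inr i \<Rightarrow> \<xi> $ i)"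

lemma lift_form_nonzero: "\<xi> \<noteq> 0 \<Longrightarrow> lift_form A \<xi> \<noteq> 0"
  by (auto simp: lift_form_def vec_eq_iff split: sum.splits)

lemma nint_dist_lift_form_le:
  fixes A :: "real ^ 'd::finite ^ 'm::finite"
  assumes "nint_dist (real_vec \<xi> \<bullet> b) \<le> \<epsilon>" "\<And>j. nint_dist (real_vec \<xi> \<bullet> column j A) \<le> \<epsilon>"
  shows "nint_dist (real_vec (lift_form A \<xi>) \<bullet> graph_point A b t)
    \<le> (1 + (\<Sum>j\<in>UNIV. \<bar>t $ j\<bar>)) * \<epsilon>"
proof -
  define r where "r j = real_vec \<xi> \<bullet> column j A" for j
  have "real_vec \<xi> \<bullet> (A *v t) = (\<Sum>i\<in>UNIV. \<Sum>j\<in>UNIV. real_vec \<xi> $ i * (A $ i $ j * t $ j))"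
    by (simp add: inner_vec_def matrix_vector_mult_def sum_distrib_left)
  also have "\<dots> = (\<Sum>j\<in>UNIV. r j * t $ j)"
    by (subst sum.swap) (simp add: r_def inner_vec_def column_def sum_distrib_right mult.assoc)
  finally have At: "real_vec \<xi> \<bullet> (A *v t) = (\<Sum>j\<in>UNIV. r j * t $ j)" .
  have entries: "real_vec (lift_form A \<xi>) $ Inl j = - of_int (round (r j))"
    "real_vec (lift_form A \<xi>) $ Inr i = real_vec \<xi> $ i" for j i
    by (simp_all add: real_vec_def lift_form_def r_def)
  have "real_vec (lift_form A \<xi>) \<bullet> graph_point A b t
      = - (\<Sum>j\<in>UNIV. of_int (round (r j)) * t $ j) + real_vec \<xi> \<bullet> (A *v t + b)"
    by (simp add: inner_vec_def[of "real_vec (lift_form A \<xi>)"]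
        inner_vec_def[of "real_vec \<xi>" "A *v t + b"] sum_UNIV_Plus entries graph_point_def sum_negf)
  also have "\<dots> = (\<Sum>j\<in>UNIV. (r j - of_int (round (r j))) * t $ j) + real_vec \<xi> \<bullet> b"
    by (simp add: inner_add_right At algebra_simps sum_subtractf)
  finally have eq: "real_vec (lift_form A \<xi>) \<bullet> graph_point A b t - of_int (round (real_vec \<xi> \<bullet> b))
      = (\<Sum>j\<in>UNIV. (r j - of_int (round (r j))) * t $ j)
        + (real_vec \<xi> \<bullet> b - of_int (round (real_vec \<xi> \<bullet> b)))"
    by simp
  have "nint_dist (real_vec (lift_form A \<xi>) \<bullet> graph_point A b t)
      \<le> \<bar>\<Sum>j\<in>UNIV. (r j - of_int (round (r j))) * t $ j\<bar> + nint_dist (real_vec \<xi> \<bullet> b)"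
    unfolding nint_dist_def[of "real_vec \<xi> \<bullet> b"]
    by (rule order_trans[OF nint_dist_le]) (subst eq, rule abs_triangle_ineq)
  also have "\<dots> \<le> (\<Sum>j\<in>UNIV. \<epsilon> * \<bar>t $ j\<bar>) + \<epsilon>"
  proof (rule add_mono[OF order_trans[OF sum_abs sum_mono] assms(1)])
    show "\<bar>(r j - of_int (round (r j))) * t $ j\<bar> \<le> \<epsilon> * \<bar>t $ j\<bar>" for j
      using assms(2)[of j] by (simp add: abs_mult nint_dist_def r_def mult_right_mono)
  qed
  finally show ?thesis by (simp add: algebra_simps sum_distrib_left)
qed

lemma mult_height_lift_form_le:
  fixes A :: "real ^ 'd::finite ^ 'm::finite"
  assumes "\<And>i. \<bar>real_of_int (\<xi> $ i)\<bar> \<le> M" "M \<ge> 1"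
  shows "of_int (mult_height (lift_form A \<xi>))
    \<le> ((1 + (\<Sum>j\<in>UNIV. \<Sum>i\<in>UNIV. \<bar>A $ i $ j\<bar>)) * M) ^ CARD('d) * of_int (mult_height \<xi>)"
proof -
  define C where "C = 1 + (\<Sum>j\<in>UNIV. \<Sum>i\<in>UNIV. \<bar>A $ i $ j\<bar>)"
  have C1: "C \<ge> 1" by (simp add: C_def sum_nonneg)
  have bound: "\<bar>of_int (round (real_vec \<xi> \<bullet> column j A))\<bar> \<le> C * M" for j
  proof -
    have "\<bar>of_int (round (real_vec \<xi> \<bullet> column j A))\<bar> \<le> 1 + \<bar>real_vec \<xi> \<bullet> column j A\<bar>"
      using of_int_round_abs_le[of "real_vec \<xi> \<bullet> column j A"] by linarith
    also have "\<bar>real_vec \<xi> \<bullet> column j A\<bar> \<le> (\<Sum>i\<in>UNIV. M * \<bar>A $ i $ j\<bar>)"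
      unfolding inner_vec_def
      by (rule order_trans[OF sum_abs sum_mono])
         (use assms(1) in \<open>simp add: real_vec_def column_def abs_mult mult_right_mono\<close>)
    also have "\<dots> = M * (\<Sum>i\<in>UNIV. \<bar>A $ i $ j\<bar>)" by (simp add: sum_distrib_left)
    also have "\<dots> \<le> M * (\<Sum>j\<in>UNIV. \<Sum>i\<in>UNIV. \<bar>A $ i $ j\<bar>)"
      using assms(2) by (intro mult_left_mono member_le_sum) (auto intro: sum_nonneg)
    finally show ?thesis using assms(2) by (simp add: C_def algebra_simps)
  qed
  have CM: "C * M \<ge> 1" using C1 assms(2) by (metis mult_mono mult_1 zero_le_one order_trans)
  have "of_int (mult_height (lift_form A \<xi>))
      = (\<Prod>j\<in>UNIV. max 1 \<bar>real_of_int (round (real_vec \<xi> \<bullet> column j A))\<bar>) * of_int (mult_height \<xi>)"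
    by (simp add: mult_height_def prod_UNIV_Plus lift_form_def of_int_max)
  also have "\<dots> \<le> (\<Prod>j\<in>(UNIV :: 'd set). C * M) * of_int (mult_height \<xi>)"
    using bound CM mult_height_ge_1[of \<xi>] by (intro mult_right_mono prod_mono) auto
  finally show ?thesis by (simp add: C_def)
qed

lemma eventually_less_powr:
  assumes "a > 0"
  shows "\<forall>\<^sub>F T in sequentially. c < real T powr a"
  using eventually_gt_at_top[of "nat \<lceil>max c 1 powr (1 / a)\<rceil>"]
proof eventually_elim
  case (elim T)
  then have "max c 1 powr (1 / a) < real T" by linarith
  then have "(max c 1 powr (1 / a)) powr a < real T powr a"
    using assms by (intro powr_less_mono2) auto
  then show ?case using assms by (simp add: powr_powr)
qed

text \<open>If \<open>\<eta>\<close> bounds the distances of the entries of \<open>\<xi> \<bullet> (A, b)\<close> to the integers, then the lifted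
  form is within \<open>D * \<eta>\<close> of an integer at \<open>x\<close>, with \<open>D\<close> depending on \<open>x\<close>, and its height is at
  most \<open>C\<close> to the power \<open>d\<close> times \<open>T powr E\<close>. Only \<open>D\<close> varies with \<open>x\<close>, and it affects from
  which \<open>T\<close> on the inequality holds, but not the exponent \<open>\<tau>\<close>. If only
  finitely many forms arise, one of them is exactly integral at \<open>x\<close>, and its multiples serve.\<close>

lemma dual_on_affine_graph:
  fixes A :: "real ^ 'd::finite ^ 'm::finite"
    and b :: "real ^ 'm"
    and \<gamma> \<sigma>\<^sub>2 :: real
  assumes \<tau>: "1 < \<tau>" "\<tau> < \<gamma>" and sigma: "\<sigma>\<^sub>2 \<ge> 0"
    and approx: "infinite {T :: nat. T > 0 \<and> (\<exists>\<xi> :: int ^ 'm. \<xi> \<noteq> 0 \<and>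
      Max (insert (nint_dist (real_vec \<xi> \<bullet> b))
            (range (\<lambda>j. nint_dist (real_vec \<xi> \<bullet> column j A))))
        < real T powr (- \<gamma> * (1 + real CARD('d) * \<sigma>\<^sub>2)) \<and>
      of_int (max_norm \<xi>) \<le> real T powr \<sigma>\<^sub>2 \<and>
      mult_height \<xi> \<le> int T)}" (is "infinite ?T")
    and x: "x \<in> affine_graph A b"
  shows "infinite {m. nint_dist (real_vec m \<bullet> x) < of_int (mult_height m) powr - \<tau>}"
proof -
  obtain t where t: "x = graph_point A b t" using x by (auto simp: affine_graph_def)
  define E where "E = 1 + real CARD('d) * \<sigma>\<^sub>2"
  have E1: "E \<ge> 1" using sigma by (simp add: E_def)
  define C where "C = 1 + (\<Sum>j\<in>UNIV. \<Sum>i\<in>UNIV. \<bar>A $ i $ j\<bar>)"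
  have C1: "C \<ge> 1" by (simp add: C_def sum_nonneg)
  define D where "D = 1 + (\<Sum>j\<in>UNIV. \<bar>t $ j\<bar>)"
  have D1: "D \<ge> 1" by (simp add: D_def sum_nonneg)
  define S where "S = {m. m \<noteq> 0 \<and> nint_dist (real_vec m \<bullet> x) < of_int (mult_height m) powr - \<tau>}"
  have "infinite S"
  proof (rule infinite_if_arbitrarily_small[where f = "\<lambda>m. nint_dist (real_vec m \<bullet> x)"])
    fix \<epsilon> :: real
    assume \<epsilon>: "\<epsilon> > 0"
    \<comment> \<open>The gap between \<open>\<tau>\<close> and \<open>\<gamma>\<close> beats the factors \<open>C\<close> and \<open>D\<close> once \<open>T\<close> is large.\<close>
    have a: "(\<gamma> - \<tau>) * E > 0" "\<gamma> * E > 0" using \<tau> E1 by auto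
    have "\<forall>\<^sub>F T in sequentially. D * (C ^ CARD('d)) powr \<tau> < real T powr ((\<gamma> - \<tau>) * E)
        \<and> D / \<epsilon> < real T powr (\<gamma> * E)"
      using a by (intro eventually_conj eventually_less_powr)
    moreover have "\<exists>\<^sub>F T in sequentially. T \<in> ?T"
      using approx unfolding cofinite_eq_sequentially[symmetric] frequently_cofinite by simp
    ultimately obtain T where T: "T \<in> ?T" "D * (C ^ CARD('d)) powr \<tau> < real T powr ((\<gamma> - \<tau>) * E)"
      "D / \<epsilon> < real T powr (\<gamma> * E)"
      using frequently_ex[OF frequently_eventually_frequently] by blast
    then obtain \<xi> where T0: "T > 0" and \<xi>: "\<xi> \<noteq> 0"
      "Max (insert (nint_dist (real_vec \<xi> \<bullet> b)) (range (\<lambda>j. nint_dist (real_vec \<xi> \<bullet> column j A))))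
        < real T powr (- \<gamma> * E)"
      "of_int (max_norm \<xi>) \<le> real T powr \<sigma>\<^sub>2" "mult_height \<xi> \<le> int T"
      unfolding E_def by blast
    define \<eta> where "\<eta> = real T powr (- \<gamma> * E)"
    define m where "m = lift_form A \<xi>"
    have T1: "real T \<ge> 1" using T0 by simp
    have dist: "nint_dist (real_vec m \<bullet> x) \<le> D * \<eta>"
      unfolding m_def t D_def \<eta>_def
      by (rule nint_dist_lift_form_le) (use \<xi>(2) in \<open>auto simp: less_imp_le\<close>)
    have M1: "real T powr \<sigma>\<^sub>2 \<ge> 1" using T1 sigma by (simp add: ge_one_powr_ge_zero)
    have "of_int (mult_height m) \<le> (C * real T powr \<sigma>\<^sub>2) ^ CARD('d) * of_int (mult_height \<xi>)"
      unfolding m_def C_def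
    proof (rule mult_height_lift_form_le[OF _ M1])
      fix i
      have "\<bar>\<xi> $ i\<bar> \<le> max_norm \<xi>" unfolding max_norm_def by (rule Max_ge) auto
      then show "\<bar>real_of_int (\<xi> $ i)\<bar> \<le> real T powr \<sigma>\<^sub>2" using \<xi>(3) by linarith
    qed
    also have "\<dots> \<le> (C * real T powr \<sigma>\<^sub>2) ^ CARD('d) * real T"
      using \<xi>(4) C1 by (intro mult_left_mono) auto
    also have "\<dots> = C ^ CARD('d) * real T powr E"
      using T1 by (simp add: E_def powr_add power_mult_distrib powr_power mult.commute)
    finally have H: "of_int (mult_height m) \<le> C ^ CARD('d) * real T powr E" .
    have H1: "real_of_int (mult_height m) \<ge> 1" using mult_height_ge_1[of m] by simp
    have "D * \<eta> < (C ^ CARD('d) * real T powr E) powr - \<tau>"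
    proof -
      have "D * (C ^ CARD('d)) powr \<tau> * real T powr (- \<gamma> * E)
          < real T powr ((\<gamma> - \<tau>) * E) * real T powr (- \<gamma> * E)"
        using T(2) T1 by (intro mult_strict_right_mono) auto
      also have "\<dots> = real T powr (- \<tau> * E)"
        by (simp add: powr_add[symmetric] algebra_simps)
      finally have "D * \<eta> * (C ^ CARD('d)) powr \<tau> < real T powr (- \<tau> * E)"
        by (simp add: \<eta>_def mult.commute mult.left_commute)
      moreover have "(C ^ CARD('d)) powr \<tau> > 0" using C1 by simp
      ultimately have "D * \<eta> < real T powr (- \<tau> * E) / (C ^ CARD('d)) powr \<tau>"
        by (simp add: pos_less_divide_eq)
      also have "\<dots> = (C ^ CARD('d) * real T powr E) powr - \<tau>"
        using C1 by (simp add: powr_mult powr_powr powr_minus divide_simps mult.commute)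
      finally show ?thesis .
    qed
    also have "\<dots> \<le> of_int (mult_height m) powr - \<tau>"
      using H H1 \<tau> by (intro powr_mono2') auto
    finally have "m \<in> S"
      using dist lift_form_nonzero[OF \<xi>(1)] by (simp add: S_def m_def)
    moreover have "D * \<eta> < \<epsilon>"
      using T(3) T1 \<epsilon> by (simp add: \<eta>_def powr_minus field_simps)
    ultimately show "\<exists>m\<in>S. nint_dist (real_vec m \<bullet> x) < \<epsilon>" using dist by force
  next
    fix m assume m: "m \<in> S" "nint_dist (real_vec m \<bullet> x) = 0"
    have rv: "real_vec (\<chi> i. j * m $ i) \<bullet> x = of_int j * (real_vec m \<bullet> x)" for j
      by (simp add: inner_vec_def real_vec_def sum_distrib_left mult.assoc)
    have zero: "nint_dist (real_vec (\<chi> i. j * m $ i) \<bullet> x) = 0" for j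
      unfolding rv nint_dist_eq_0_iff using m(2) by (intro Ints_mult) (auto simp: nint_dist_eq_0_iff)
    obtain i where i: "m $ i \<noteq> 0" using m(1) by (auto simp: S_def vec_eq_iff)
    have "of_int (mult_height (\<chi> i. j * m $ i)) powr - \<tau> > 0" for j
      using mult_height_ge_1[of "\<chi> i. j * m $ i"] by simp
    then have "(\<lambda>j. \<chi> i. j * m $ i) ` {1..} \<subseteq> S"
      using i by (auto simp: S_def zero vec_eq_iff)
    moreover have "infinite ((\<lambda>j. \<chi> i. j * m $ i) ` {1..})"
      using i by (subst finite_image_iff) (auto simp: inj_on_def vec_eq_iff infinite_Ici)
    ultimately show "infinite S" by (rule infinite_super)
  qed (simp add: nint_dist_nonneg)
  then show ?thesis by (rule infinite_super[rotated]) (auto simp: S_def)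
qed

section \<open>Gallagher sets and the induced measure\<close>

lemma W_mult_in_borel: "(W_mult \<psi> :: (real ^ 'n::finite) set) \<in> sets borel"
proof -
  have [measurable]: "nint_dist \<in> borel_measurable borel"
    unfolding nint_dist_def[abs_def] round_def by measurable
  have [measurable]: "(\<lambda>x :: real ^ 'n. x $ i) \<in> borel_measurable borel" for i
    by (intro borel_measurable_continuous_onI continuous_intros)
  have "W_mult \<psi> = {x :: real ^ 'n. \<forall>N. \<exists>q\<ge>N.
      q \<ge> 1 \<and> (\<Prod>i\<in>UNIV. nint_dist (real q * x $ i)) < \<psi> q}"
    unfolding W_mult_def infinite_nat_iff_unbounded_le by simp
  also have "\<dots> \<in> sets borel" by measurable
  finally show ?thesis .
qed

text \<open>The matrices \<open>1 + u *\<^sub>R (transpose A ** A)\<close> with \<open>u \<ge> 0\<close> are positive definite, hence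
  invertible. Their determinant is \<open>1\<close> at \<open>u = 0\<close> and never vanishes, so by continuity it is
  still positive at \<open>u = 1\<close>.\<close>

lemma det_one_plus_gram_pos:
  fixes A :: "real ^ 'd::finite ^ 'm::finite"
  shows "det (mat 1 + transpose A ** A) > 0"
proof -
  define M where "M u = mat 1 + u *\<^sub>R (transpose A ** A)" for u :: real
  have nz: "det (M u) \<noteq> 0" if "u \<ge> 0" for u
  proof -
    have "v = 0" if v: "M u *v v = 0" for v
    proof -
      have "0 = v \<bullet> (M u *v v)" using v by simp
      also have "\<dots> = v \<bullet> v + u * (v \<bullet> (transpose A *v (A *v v)))"
        by (simp add: M_def matrix_vector_mult_add_rdistrib inner_add_right
            scaleR_matrix_vector_assoc[symmetric] matrix_vector_mul_assoc)
      also have "v \<bullet> (transpose A *v (A *v v)) = (A *v v) \<bullet> (A *v v)"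
        by (metis dot_lmul_matrix inner_commute transpose_matrix_vector)
      finally have "v \<bullet> v + u * ((A *v v) \<bullet> (A *v v)) = 0" by simp
      moreover have "u * ((A *v v) \<bullet> (A *v v)) \<ge> 0" using \<open>u \<ge> 0\<close> by simp
      ultimately show "v = 0" by (metis add_nonneg_eq_0_iff inner_eq_zero_iff inner_ge_zero)
    qed
    then show ?thesis
      by (metis invertible_det_nz invertible_left_inverse matrix_left_invertible_ker)
  qed
  have "continuous_on {0..1} (\<lambda>u. det (M u))"
    unfolding det_def M_def by (intro continuous_intros) 
  then have "\<not> det (M 1) \<le> 0"
    using IVT2'[of "\<lambda>u. det (M u)" 1 0 0] nz by (force simp: M_def)
  then show ?thesis by (simp add: M_def)
qed

lemma emeasure_induced_lebesgue_superset:
  fixes A :: "real ^ 'd::finite ^ 'm::finite"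
  assumes W: "W \<in> sets borel" "affine_graph A b \<subseteq> W"
  shows "emeasure (induced_lebesgue A b) W = \<infinity>"
proof -
  have "continuous_on UNIV (graph_point A b)"
    unfolding graph_point_def
  proof (rule continuous_on_vec_lambda)
    show "continuous_on UNIV (\<lambda>t. case k of Inl j \<Rightarrow> t $ j | Inr i \<Rightarrow> (A *v t + b) $ i)" for k
      by (cases k) (auto intro!: continuous_intros simp: matrix_vector_mult_def)
  qed
  then have [measurable]: "graph_point A b \<in> borel_measurable borel"
    by (rule borel_measurable_continuous_onI)
  have "graph_point A b -` W = UNIV" using W(2) by (auto simp: affine_graph_def)
  then have "emeasure (distr lborel borel (graph_point A b)) W = \<infinity>"
    using W(1) by (subst emeasure_distr) auto
  then show ?thesis
    using det_one_plus_gram_pos[of A]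
    by (simp add: induced_lebesgue_def ennreal_mult_top ennreal_eq_0_iff)
qed

lemma summable_powr_times_ln_power:
  assumes "\<kappa> > 1"
  shows "summable (\<lambda>q. real (Suc q) powr - \<kappa> / 2 * ln (real (Suc q)) ^ k)"
proof -
  \<comment> \<open>The logarithms cost \<open>e * k\<close> in the exponent, less than half of the excess \<open>\<kappa> - 1\<close>.\<close>
  define e where "e = (\<kappa> - 1) / (2 * (real k + 1))"
  have e: "e > 0" using assms by (simp add: e_def)
  have "e * real k \<le> e * (real k + 1)" using e by simp
  also have "\<dots> = (\<kappa> - 1) / 2" unfolding e_def by (simp add: field_simps)
  finally have ek: "e * real k - \<kappa> < -1" using assms by simp
  have "summable (\<lambda>q. real (Suc q) powr (e * real k - \<kappa>) * (1 / e) ^ k / 2)"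
    using ek summable_real_powr_iff[of "e * real k - \<kappa>"]
      summable_Suc_iff[of "\<lambda>n. real n powr (e * real k - \<kappa>)"]
    by (intro summable_divide summable_mult2) blast
  then show ?thesis
  proof (rule summable_comparison_test'[where N = 0])
    fix q :: nat
    have l: "0 \<le> ln (real (Suc q))" "ln (real (Suc q)) \<le> real (Suc q) powr e / e"
      using e by (auto intro: ln_powr_bound simp del: of_nat_Suc)
    have "ln (real (Suc q)) ^ k \<le> (real (Suc q) powr e / e) ^ k"
      by (rule power_mono[OF l(2,1)])
    also have "\<dots> = real (Suc q) powr (e * real k) * (1 / e) ^ k"
      by (simp add: power_divide powr_power mult.commute del: of_nat_Suc)
    finally have "real (Suc q) powr - \<kappa> / 2 * ln (real (Suc q)) ^ k
        \<le> real (Suc q) powr - \<kappa> / 2 * (real (Suc q) powr (e * real k) * (1 / e) ^ k)"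
      by (intro mult_left_mono) auto
    also have "\<dots> = real (Suc q) powr (e * real k - \<kappa>) * (1 / e) ^ k / 2"
      by (simp add: powr_diff powr_minus divide_simps del: of_nat_Suc)
    finally show "norm (real (Suc q) powr - \<kappa> / 2 * ln (real (Suc q)) ^ k)
        \<le> real (Suc q) powr (e * real k - \<kappa>) * (1 / e) ^ k / 2"
      using l(1) by (simp del: of_nat_Suc)
  qed
qed

theorem lemma3p6:
  fixes A :: "real ^ 'd::finite ^ 'm::finite"
    and b :: "real ^ 'm"
    and \<gamma> \<sigma>\<^sub>2 :: real
  assumes proj_surj: "\<And>S :: ('d + 'm) set. card S = CARD('d) \<Longrightarrow>
      axis_proj S ` affine_graph A b = axis_subspace S"
    and gamma: "\<gamma> > 1"
    and sigma: "\<sigma>\<^sub>2 \<ge> 1 / real CARD('m)"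
    and approx: "infinite {T :: nat. T > 0 \<and> (\<exists>\<xi> :: int ^ 'm. \<xi> \<noteq> 0 \<and>
      Max (insert (nint_dist (real_vec \<xi> \<bullet> b))
            (range (\<lambda>j. nint_dist (real_vec \<xi> \<bullet> column j A))))
        < real T powr (- \<gamma> * (1 + real CARD('d) * \<sigma>\<^sub>2)) \<and>
      of_int (max_norm \<xi>) \<le> real T powr \<sigma>\<^sub>2 \<and>
      mult_height \<xi> \<le> int T)}"
  shows "(\<forall>x \<in> affine_graph A b. very_well_mult_approximable x) \<and>
    \<not> convergent_Gallagher (induced_lebesgue A b)"
proof -
  define \<tau> where "\<tau> = (1 + \<gamma>) / 2"
  have \<tau>: "1 < \<tau>" "\<tau> < \<gamma>" using gamma by (auto simp: \<tau>_def)
  have "\<sigma>\<^sub>2 \<ge> 0" using sigma by (meson divide_nonneg_nonneg of_nat_0_le_iff order_trans zero_le_one)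
  note dual = dual_on_affine_graph[OF \<tau> this approx]
  \<comment> \<open>The same exponent for all points of the subspace.\<close>
  define \<kappa> where "\<kappa> = 1 + ((\<tau> - 1) / real CARD('d + 'm)) / (2 * \<tau>)"
  have "(\<tau> - 1) / real CARD('d + 'm) / (2 * \<tau>) > 0"
    using \<tau> by (intro divide_pos_pos) (auto simp: add_pos_pos)
  then have \<kappa>: "\<kappa> > 1" by (simp add: \<kappa>_def)
  have simult: "infinite {q::nat. q \<ge> 1 \<and>
      (\<Prod>i\<in>UNIV. nint_dist (real q * x $ i)) < real q powr - \<kappa> / 2}"
    if "x \<in> affine_graph A b" for x
    using simultaneous_from_dual[OF \<tau>(1) dual[OF that]] unfolding \<kappa>_def .
  have "very_well_mult_approximable x" if x: "x \<in> affine_graph A b" for x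
  proof -
    let ?S = "{q::nat. q \<ge> 1 \<and> (\<Prod>i\<in>UNIV. nint_dist (real q * x $ i)) < real q powr - \<kappa> / 2}"
    have "infinite (int ` ?S)" using simult[OF x] by (simp add: finite_image_iff)
    moreover have "int ` ?S \<subseteq>
        {q. (\<Prod>i\<in>UNIV. nint_dist (of_int q * x $ i)) < of_int \<bar>q\<bar> powr - \<kappa>}"
    proof (rule image_subsetI)
      fix q
      assume "q \<in> ?S"
      moreover have "real q powr - \<kappa> \<ge> 0" by simp
      ultimately have "(\<Prod>i\<in>UNIV. nint_dist (real q * x $ i)) < real q powr - \<kappa>"
        unfolding mem_Collect_eq by linarith
      then show "int q \<in> {q. (\<Prod>i\<in>UNIV. nint_dist (of_int q * x $ i)) < of_int \<bar>q\<bar> powr - \<kappa>}"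
        by simp
    qed
    ultimately have "vwma_simultaneous x"
      unfolding vwma_simultaneous_def using \<kappa> infinite_super by blast
    moreover have "vwma_dual x" unfolding vwma_dual_def using dual[OF x] \<tau>(1) by blast
    ultimately show ?thesis by (simp add: very_well_mult_approximable_def)
  qed
  moreover have "\<not> convergent_Gallagher (induced_lebesgue A b)"
  proof
    assume "convergent_Gallagher (induced_lebesgue A b)"
    moreover define \<psi> where "\<psi> q = real q powr - \<kappa> / 2" for q :: nat
    moreover have "0 \<le> \<psi> q \<and> \<psi> q < 1" if "q \<ge> 1" for q
    proof -
      have "real q powr - \<kappa> \<le> 1 powr - \<kappa>" using that \<kappa> by (intro powr_mono2') auto
      then show ?thesis by (simp add: \<psi>_def)
    qed
    moreover have "\<psi> q \<le> \<psi> p" if "1 \<le> p" "p \<le> q" for p q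
      unfolding \<psi>_def using that \<kappa> by (intro divide_right_mono powr_mono2') auto
    moreover have "summable (\<lambda>q. \<psi> (Suc q) * ln (real (Suc q)) ^ (CARD('d + 'm) - 1))"
      unfolding \<psi>_def by (rule summable_powr_times_ln_power[OF \<kappa>])
    ultimately have "emeasure (induced_lebesgue A b) (W_mult \<psi>) = 0"
      unfolding convergent_Gallagher_def by blast
    moreover have "affine_graph A b \<subseteq> W_mult \<psi>"
      using simult by (auto simp: W_mult_def \<psi>_def)
    then have "emeasure (induced_lebesgue A b) (W_mult \<psi>) = \<infinity>"
      by (rule emeasure_induced_lebesgue_superset[OF W_mult_in_borel])
    ultimately show False by simp
  qed
  ultimately show ?thesis by blast
qed

end
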